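(* Let $R$ be a ring such that, for every positive integer $n$, every $n$-absorbing ideal of $R$ is strongly $n$-absorbing. Let $B$ be an amount $R$-algebra, with amount function $A: B\to \mathrm{Id}(R)$, $f\mapsto A_f$, and function $\epsilon:\mathrm{Id}(R)\to\mathrm{Id}(B)$, $I\mapsto I^{\epsilon}$. If $B$ is Gaussian, then $\omega_B(I^{\epsilon})=\omega_R(I)$ for every ideal $I$ of $R$.
   Context: All rings are commutative with identity and all algebras are unitary (and commutative). $\mathrm{Id}(R)$ denotes the set of all ideals of a ring $R$; $J^0=R$ for an ideal $J$ of $R$. Amount function: for an $R$-algebra $B$, a function $A: B\to\mathrm{Id}(R)$, $f\mapsto A_f$, is an amount function if for all $r\in R$ and $f,g\in B$: (1) $A_0=(0)$ and $A_1=R$; (2) $A_f=(0)$ implies $f=0$; (3) $A_{rf}=rA_f$; (4) $A_{fg}\subseteq A_fA_g$. Amount algebra: an $R$-algebra $B$ is an amount $R$-algebra if (1) there is an amount function $A:B\to\mathrm{Id}(R)$ such that for all $f,g\in B$ there are non-negative integers $m,n$ with $A_f^mA_g^nA_{fg}=A_f^{m+1}A_g^{n+1}$; and (2) there is a function $\epsilon:\mathrm{Id}(R)\to\mathrm{Id}(B)$, $I\mapsto I^{\epsilon}$, such that (a) $A_f\subseteq I$ if and only if $f\in I^{\epsilon}$, for all $f\in B$ and $I\in\mathrm{Id}(R)$, and (b) $I^{\epsilon}\cap R=I$ for all $I\in\mathrm{Id}(R)$ (where $I^\epsilon\cap R$ is the preimage of $I^\epsilon$ under the structure map $R\to B$).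 Gaussian: an amount $R$-algebra $B$ (with amount function $A$) is Gaussian if $A_{fg}=A_fA_g$ for all $f,g\in B$. Absorbing ideals: for a positive integer $n$, a proper ideal $I$ of $R$ is $n$-absorbing if whenever $r_1\cdots r_{n+1}\in I$ with $r_1,\ldots,r_{n+1}\in R$, there are $n$ of the $r_i$'s whose product is in $I$. A proper ideal $I$ of $R$ is strongly $n$-absorbing if whenever $I_1\cdots I_{n+1}\subseteq I$ for ideals $I_1,\ldots,I_{n+1}$ of $R$, there are $n$ of the $I_i$'s whose product is contained in $I$. If $I$ is $n$-absorbing for some positive integer $n$, then $\omega_R(I)=\min\{n : I \text{ is an } n\text{-absorbing ideal of } R\}$; otherwise $\omega_R(I)=\infty$. *)

theory Defs
  imports
    "HOL-Algebra.Ideal_Product"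
    "HOL-Algebra.Module"
    "HOL-Library.Extended_Nat"
begin

section \<open>Amount algebras\<close>

text \<open>
  The ideals of \<open>R\<close> form the commutative monoid \<open>ideals_set R\<close>, whose multiplication is
  the ideal product and whose unit is \<open>carrier R\<close>. Powers and finite products of ideals are
  taken there; in particular the zeroth power of an ideal is the whole ring.
\<close>

locale amount_function = algebra R B for R (structure) and B (structure) +
  fixes A :: "'b \<Rightarrow> 'a set"
  assumes amount_ideal: "f \<in> carrier B \<Longrightarrow> ideal (A f) R"
    and amount_zero: "A \<zero>\<^bsub>B\<^esub> = {\<zero>\<^bsub>R\<^esub>}"
    and amount_one: "A \<one>\<^bsub>B\<^esub> = carrier R"
    and amount_eq_zero: "\<lbrakk> f \<in> carrier B; A f = {\<zero>\<^bsub>R\<^esub>} \<rbrakk> \<Longrightarrow> f = \<zero>\<^bsub>B\<^esub>"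
    and amount_smult:
      "\<lbrakk> r \<in> carrier R; f \<in> carrier B \<rbrakk> \<Longrightarrow> A (r \<odot>\<^bsub>B\<^esub> f) = (\<lambda>a. r \<otimes>\<^bsub>R\<^esub> a) ` A f"
    and amount_mult:
      "\<lbrakk> f \<in> carrier B; g \<in> carrier B \<rbrakk> \<Longrightarrow> A (f \<otimes>\<^bsub>B\<^esub> g) \<subseteq> A f \<cdot>\<^bsub>R\<^esub> A g"

text \<open>
  The structure map of the algebra sends \<open>r\<close> to \<open>r \<odot>\<^bsub>B\<^esub> \<one>\<^bsub>B\<^esub>\<close>. The maps \<open>A\<close> and \<open>\<epsilon>\<close> are
  unconstrained outside the elements of \<open>B\<close> and the ideals of \<open>R\<close>, respectively.
\<close>

locale amount_algebra = amount_function R B A for R (structure) and B (structure) and A +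
  fixes \<epsilon> :: "'a set \<Rightarrow> 'b set"
  assumes amount_content_formula:
      "\<lbrakk> f \<in> carrier B; g \<in> carrier B \<rbrakk> \<Longrightarrow>
        \<exists>(m::nat) (n::nat).
          (A f [^]\<^bsub>ideals_set R\<^esub> m) \<cdot>\<^bsub>R\<^esub> (A g [^]\<^bsub>ideals_set R\<^esub> n) \<cdot>\<^bsub>R\<^esub> A (f \<otimes>\<^bsub>B\<^esub> g) =
          (A f [^]\<^bsub>ideals_set R\<^esub> (m + 1)) \<cdot>\<^bsub>R\<^esub> (A g [^]\<^bsub>ideals_set R\<^esub> (n + 1))"
    and eps_ideal: "ideal I R \<Longrightarrow> ideal (\<epsilon> I) B"
    and amount_subset_iff: "\<lbrakk> f \<in> carrier B; ideal I R \<rbrakk> \<Longrightarrow> A f \<subseteq> I \<longleftrightarrow> f \<in> \<epsilon> I"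
    and eps_contract: "ideal I R \<Longrightarrow> {r \<in> carrier R. r \<odot>\<^bsub>B\<^esub> \<one>\<^bsub>B\<^esub> \<in> \<epsilon> I} = I"

locale gaussian_amount_algebra = amount_algebra R B A \<epsilon>
  for R (structure) and B (structure) and A and \<epsilon> +
  assumes gaussian:
    "\<lbrakk> f \<in> carrier B; g \<in> carrier B \<rbrakk> \<Longrightarrow> A (f \<otimes>\<^bsub>B\<^esub> g) = A f \<cdot>\<^bsub>R\<^esub> A g"


section \<open>Absorbing ideals\<close>

definition n_absorbing :: "('a, 'm) ring_scheme \<Rightarrow> nat \<Rightarrow> 'a set \<Rightarrow> bool"
  where "n_absorbing R n I \<longleftrightarrow>
    0 < n \<and> ideal I R \<and> I \<noteq> carrier R \<and>
    (\<forall>r \<in> {1..n + 1} \<rightarrow> carrier R.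
      (\<Otimes>\<^bsub>R\<^esub>i\<in>{1..n + 1}. r i) \<in> I \<longrightarrow>
      (\<exists>S \<subseteq> {1..n + 1}. card S = n \<and> (\<Otimes>\<^bsub>R\<^esub>i\<in>S. r i) \<in> I))"

definition strongly_n_absorbing :: "('a, 'm) ring_scheme \<Rightarrow> nat \<Rightarrow> 'a set \<Rightarrow> bool"
  where "strongly_n_absorbing R n I \<longleftrightarrow>
    0 < n \<and> ideal I R \<and> I \<noteq> carrier R \<and>
    (\<forall>J \<in> {1..n + 1} \<rightarrow> {K. ideal K R}.
      (\<Otimes>\<^bsub>ideals_set R\<^esub>i\<in>{1..n + 1}. J i) \<subseteq> I \<longrightarrow>
      (\<exists>S \<subseteq> {1..n + 1}. card S = n \<and> (\<Otimes>\<^bsub>ideals_set R\<^esub>i\<in>S. J i) \<subseteq> I))"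

text \<open>The improper ideal is not \<open>n\<close>-absorbing for any \<open>n\<close>, so its value here is \<open>\<infinity>\<close>.\<close>

definition absorbing_number :: "('a, 'm) ring_scheme \<Rightarrow> 'a set \<Rightarrow> enat" (\<open>\<omega>\<index>\<close>)
  where "\<omega>\<^bsub>R\<^esub> I = (if \<exists>n. n_absorbing R n I then enat (LEAST n. n_absorbing R n I) else \<infinity>)"

end

theory Submission
  imports Defs
begin

text \<open>
  For every positive \<open>n\<close> the ideals \<open>I\<close> and \<open>\<epsilon> I\<close> are \<open>n\<close>-absorbing or not together, which makes
  their absorbing numbers equal. The reason is that \<open>n\<close>-absorption only speaks of finite products,
  and there are two multiplicative maps along which such products can be transported between the
  two rings.

  From \<open>R\<close> to \<open>B\<close> one has the structure map \<open>r \<mapsto> r \<odot> \<one>\<close>. As \<open>I\<close> is the contraction of \<open>\<epsilon> I\<close>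
  along it, a product in \<open>I\<close> is sent to a product in \<open>\<epsilon> I\<close>, where one factor can be dropped
  if \<open>\<epsilon> I\<close> is \<open>n\<close>-absorbing, and the smaller product contracts back into \<open>I\<close>.

  From \<open>B\<close> to the ideals of \<open>R\<close> one has the amount function, which is multiplicative precisely
  because \<open>B\<close> is Gaussian. A product in \<open>\<epsilon> I\<close> is a product of amounts contained in \<open>I\<close>. Its
  factors are ideals and not elements, so it is the strong form of \<open>n\<close>-absorption of \<open>I\<close> that
  drops one of them; this is where the hypothesis that \<open>n\<close>-absorbing ideals of \<open>R\<close> are strongly
  \<open>n\<close>-absorbing enters.
\<close>

lemma comm_monoid_hom_finprod:
  assumes G: "comm_monoid G" and H: "comm_monoid H"
    and hom: "h \<in> hom G H" and one: "h \<one>\<^bsub>G\<^esub> = \<one>\<^bsub>H\<^esub>"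
    and f: "f \<in> S \<rightarrow> carrier G"
  shows "h (\<Otimes>\<^bsub>G\<^esub>i\<in>S. f i) = (\<Otimes>\<^bsub>H\<^esub>i\<in>S. h (f i))"
proof -
  interpret G: comm_monoid G by (rule G)
  interpret H: comm_monoid H by (rule H)
  show ?thesis
    using f
  proof (induction S rule: infinite_finite_induct)
    case (insert x F)
    then have "(\<lambda>i. h (f i)) \<in> insert x F \<rightarrow> carrier H"
      using hom by (auto simp: hom_def)
    with insert show ?case
      using hom by (simp add: Pi_def hom_mult)
  qed (simp_all add: one)
qed

lemma (in algebra) structure_map_finprod:
  assumes "r \<in> S \<rightarrow> carrier R"
  shows "(\<Otimes>\<^bsub>R\<^esub>i\<in>S. r i) \<odot>\<^bsub>M\<^esub> \<one>\<^bsub>M\<^esub> = (\<Otimes>\<^bsub>M\<^esub>i\<in>S. r i \<odot>\<^bsub>M\<^esub> \<one>\<^bsub>M\<^esub>)"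
proof (rule comm_monoid_hom_finprod[OF R.comm_monoid_axioms cring.axioms(2)[OF M_cring] _ _ assms])
  show "(\<lambda>r. r \<odot>\<^bsub>M\<^esub> \<one>\<^bsub>M\<^esub>) \<in> hom R M"
    by (auto simp: hom_def smult_assoc1 smult_assoc2)
qed simp

lemma (in amount_algebra) eps_proper_iff:
  assumes "ideal I R"
  shows "\<epsilon> I = carrier B \<longleftrightarrow> I = carrier R"
proof -
  have "\<epsilon> I = carrier B \<longleftrightarrow> \<one>\<^bsub>B\<^esub> \<in> \<epsilon> I"
    using eps_ideal[OF assms] by (metis ideal.one_imp_carrier monoid.one_closed ideal.axioms(2) ring.is_monoid)
  also have "\<dots> \<longleftrightarrow> carrier R \<subseteq> I"
    using amount_subset_iff[OF _ assms, of "\<one>\<^bsub>B\<^esub>"] amount_one by simp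
  also have "\<dots> \<longleftrightarrow> I = carrier R"
    using ideal.Icarr[OF assms] by blast
  finally show ?thesis .
qed

text \<open>
  As \<open>I\<close> is the contraction of \<open>\<epsilon> I\<close> along the structure map, a product of elements of \<open>R\<close>
  lies in \<open>I\<close> exactly when the product of their images lies in \<open>\<epsilon> I\<close>.
\<close>

lemma (in amount_algebra) n_absorbing_contract:
  assumes I: "ideal I R" and absorbing: "n_absorbing B n (\<epsilon> I)"
  shows "n_absorbing R n I"
  unfolding n_absorbing_def
proof (intro conjI ballI impI)
  show "0 < n" and "ideal I R" and "I \<noteq> carrier R"
    using absorbing I eps_proper_iff[OF I] by (simp_all add: n_absorbing_def)
next
  fix r
  assume r: "r \<in> {1..n + 1} \<rightarrow> carrier R" and prod: "(\<Otimes>\<^bsub>R\<^esub>i\<in>{1..n + 1}. r i) \<in> I"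
  have transport: "(\<Otimes>\<^bsub>R\<^esub>i\<in>S. r i) \<in> I \<longleftrightarrow> (\<Otimes>\<^bsub>B\<^esub>i\<in>S. r i \<odot>\<^bsub>B\<^esub> \<one>\<^bsub>B\<^esub>) \<in> \<epsilon> I"
    if "S \<subseteq> {1..n + 1}" for S
  proof -
    have rS: "r \<in> S \<rightarrow> carrier R"
      using r that by blast
    then have "(\<Otimes>\<^bsub>R\<^esub>i\<in>S. r i) \<in> carrier R"
      by (rule R.finprod_closed)
    then have "(\<Otimes>\<^bsub>R\<^esub>i\<in>S. r i) \<in> I \<longleftrightarrow> (\<Otimes>\<^bsub>R\<^esub>i\<in>S. r i) \<odot>\<^bsub>B\<^esub> \<one>\<^bsub>B\<^esub> \<in> \<epsilon> I"
      using eps_contract[OF I] by blast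
    then show ?thesis
      by (simp only: structure_map_finprod[OF rS])
  qed
  have "(\<lambda>i. r i \<odot>\<^bsub>B\<^esub> \<one>\<^bsub>B\<^esub>) \<in> {1..n + 1} \<rightarrow> carrier B"
    using r by auto
  moreover have "(\<Otimes>\<^bsub>B\<^esub>i\<in>{1..n + 1}. r i \<odot>\<^bsub>B\<^esub> \<one>\<^bsub>B\<^esub>) \<in> \<epsilon> I"
    using transport prod by blast
  ultimately obtain S where "S \<subseteq> {1..n + 1}" "card S = n"
    "(\<Otimes>\<^bsub>B\<^esub>i\<in>S. r i \<odot>\<^bsub>B\<^esub> \<one>\<^bsub>B\<^esub>) \<in> \<epsilon> I"
    using absorbing unfolding n_absorbing_def by blast
  then show "\<exists>S\<subseteq>{1..n + 1}. card S = n \<and> (\<Otimes>\<^bsub>R\<^esub>i\<in>S. r i) \<in> I"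
    using transport by blast
qed

text \<open>
  The Gaussian property says that the amount function is a homomorphism from the multiplicative
  monoid of \<open>B\<close> to the monoid of ideals of \<open>R\<close>.
\<close>

lemma (in gaussian_amount_algebra) amount_finprod:
  assumes "f \<in> S \<rightarrow> carrier B"
  shows "A (\<Otimes>\<^bsub>B\<^esub>i\<in>S. f i) = (\<Otimes>\<^bsub>ideals_set R\<^esub>i\<in>S. A (f i))"
proof (rule comm_monoid_hom_finprod[OF cring.axioms(2)[OF M_cring] R.ideals_set_is_comm_monoid _ _ assms])
  show "A \<in> hom B (ideals_set R)"
    by (auto simp: hom_def ideals_set_def amount_ideal gaussian)
  show "A \<one>\<^bsub>B\<^esub> = \<one>\<^bsub>ideals_set R\<^esub>"
    by (simp add: ideals_set_def amount_one)
qed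

text \<open>
  A product lies in \<open>\<epsilon> I\<close> exactly when the product of the amounts of its factors lies in \<open>I\<close>.
  These amounts are ideals that need not be principal, which is why the absorption of \<open>I\<close> is
  assumed in its strong form.
\<close>

lemma (in gaussian_amount_algebra) n_absorbing_eps:
  assumes absorbing: "strongly_n_absorbing R n I"
  shows "n_absorbing B n (\<epsilon> I)"
  unfolding n_absorbing_def
proof (intro conjI ballI impI)
  have I: "ideal I R"
    using absorbing by (simp add: strongly_n_absorbing_def)
  show "0 < n" and "ideal (\<epsilon> I) B" and "\<epsilon> I \<noteq> carrier B"
    using absorbing eps_ideal[OF I] eps_proper_iff[OF I]
    by (simp_all add: strongly_n_absorbing_def)
  fix f
  assume f: "f \<in> {1..n + 1} \<rightarrow> carrier B" and prod: "(\<Otimes>\<^bsub>B\<^esub>i\<in>{1..n + 1}. f i) \<in> \<epsilon> I"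
  have transport: "(\<Otimes>\<^bsub>B\<^esub>i\<in>S. f i) \<in> \<epsilon> I \<longleftrightarrow> (\<Otimes>\<^bsub>ideals_set R\<^esub>i\<in>S. A (f i)) \<subseteq> I"
    if "S \<subseteq> {1..n + 1}" for S
  proof -
    have fS: "f \<in> S \<rightarrow> carrier B"
      using f that by blast
    then have "(\<Otimes>\<^bsub>B\<^esub>i\<in>S. f i) \<in> carrier B"
      by (rule comm_monoid.finprod_closed[OF cring.axioms(2)[OF M_cring]])
    from amount_subset_iff[OF this I] show ?thesis
      by (simp only: amount_finprod[OF fS])
  qed
  have "(\<lambda>i. A (f i)) \<in> {1..n + 1} \<rightarrow> {K. ideal K R}"
    using f amount_ideal by auto
  moreover have "(\<Otimes>\<^bsub>ideals_set R\<^esub>i\<in>{1..n + 1}. A (f i)) \<subseteq> I"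
    using transport prod by blast
  ultimately obtain S where "S \<subseteq> {1..n + 1}" "card S = n"
    "(\<Otimes>\<^bsub>ideals_set R\<^esub>i\<in>S. A (f i)) \<subseteq> I"
    using absorbing unfolding strongly_n_absorbing_def by blast
  then show "\<exists>S\<subseteq>{1..n + 1}. card S = n \<and> (\<Otimes>\<^bsub>B\<^esub>i\<in>S. f i) \<in> \<epsilon> I"
    using transport by blast
qed

theorem theorem22:
  fixes R :: "('a, 'm) ring_scheme"
    and B :: "('a, 'b, 'c) module_scheme"
    and A :: "'b \<Rightarrow> 'a set"
    and \<epsilon> :: "'a set \<Rightarrow> 'b set"
  assumes absorbing: "\<And>n J. 0 < n \<Longrightarrow> n_absorbing R n J \<Longrightarrow> strongly_n_absorbing R n J"
    and gaussian: "gaussian_amount_algebra R B A \<epsilon>"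
  shows "\<forall>I. ideal I R \<longrightarrow> \<omega>\<^bsub>B\<^esub> (\<epsilon> I) = \<omega>\<^bsub>R\<^esub> I"
proof (intro allI impI)
  fix I
  assume I: "ideal I R"
  interpret gaussian_amount_algebra R B A \<epsilon>
    by (rule gaussian)
  have "n_absorbing B n (\<epsilon> I) \<longleftrightarrow> n_absorbing R n I" for n
  proof
    assume "n_absorbing R n I"
    then have "strongly_n_absorbing R n I"
      using absorbing by (simp add: n_absorbing_def)
    then show "n_absorbing B n (\<epsilon> I)"
      by (rule n_absorbing_eps)
  qed (rule n_absorbing_contract[OF I])
  then show "\<omega>\<^bsub>B\<^esub> (\<epsilon> I) = \<omega>\<^bsub>R\<^esub> I"
    by (simp add: absorbing_number_def)
qed

end
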